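(* Let $\varphi(z)=1+B_1z+B_2z^2+B_3z^3+\cdots$ be a Ma–Minda function on $\mathbb{D}$ (so in particular $B_1>0$ and all $B_i$ are real), and let $f\in\mathcal{S}^*(\varphi)$ have logarithmic coefficients $\gamma_1,\gamma_2,\gamma_3,\dots$. Put $\mu_1=2B_2/B_1$ and $\nu_1=B_3/B_1$. If $|B_2|\ge B_1$ and $(\mu_1,\nu_1)\in D_1\cup D_2\cup D_3$, then $$|\gamma_2^2-\gamma_3^2|\le\frac{1}{144}\left(9B_2^2+4B_3^2\right).$$ The bound is sharp: for every such $\varphi$ satisfying these conditions there is a function in $\mathcal{S}^*(\varphi)$ for which equality holds.
   Context: $\mathbb{D}=\{z\in\mathbb{C}:|z|<1\}$. $\mathcal{S}$ is the class of univalent analytic functions $f$ on $\mathbb{D}$ of the form $f(z)=z+\sum_{n\ge2}a_nz^n$. The logarithmic coefficients $\gamma_n=\gamma_n(f)$ of $f\in\mathcal{S}$ are defined by $\log\frac{f(z)}{z}=2\sum_{n=1}^\infty\gamma_nz^n$, $z\in\mathbb{D}$, where $\log 1=0$. A Schwarz function is an analytic $\omega:\mathbb{D}\to\mathbb{D}$ with $\omega(0)=0$. For analytic $g,h$ on $\mathbb{D}$, $g\prec h$ ($g$ is subordinate to $h$) means $g=h\circ\omega$ for some Schwarz function $\omega$. A Ma–Minda function is an analytic univalent function $\varphi$ on $\mathbb{D}$ with positive real part such that $\varphi(0)=1$, $\varphi'(0)>0$, and $\varphi(\mathbb{D})$ is symmetric with respect to the real axis and starlike with respect to $\varphi(0)=1$.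 Its Taylor expansion is written $\varphi(z)=1+B_1z+B_2z^2+B_3z^3+\cdots$, $B_1>0$. $\mathcal{S}^*(\varphi)=\{f\in\mathcal{S}: zf'(z)/f(z)\prec\varphi(z)\}$. The subsets $D_1,D_2,D_3$ of $\mathbb{R}^2$ are $D_1=\{(\mu,\nu):|\mu|\le2,\ \nu\ge1\}$, $D_2=\{(\mu,\nu):2\le|\mu|\le4,\ \nu\ge\frac1{12}(\mu^2+8)\}$, $D_3=\{(\mu,\nu):|\mu|\ge4,\ \nu\ge\frac23(|\mu|-1)\}$. *)

theory Defs
  imports "HOL-Complex_Analysis.Complex_Analysis"
begin

abbreviation unit_disc :: "complex set" where
  "unit_disc \<equiv> ball 0 1"

definition taylor_coeff :: "(complex \<Rightarrow> complex) \<Rightarrow> nat \<Rightarrow> complex" where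
  "taylor_coeff f n = (deriv ^^ n) f 0 / fact n"

lemma taylor_coeff_sums:
  assumes "f holomorphic_on unit_disc" "z \<in> unit_disc"
  shows "(\<lambda>n. taylor_coeff f n * z ^ n) sums f z"
  using holomorphic_power_series[OF assms] by (simp add: taylor_coeff_def)

definition class_S :: "(complex \<Rightarrow> complex) set" where
  "class_S = {f. f holomorphic_on unit_disc \<and> inj_on f unit_disc \<and> f 0 = 0 \<and> deriv f 0 = 1}"

definition log_branch :: "(complex \<Rightarrow> complex) \<Rightarrow> (complex \<Rightarrow> complex) \<Rightarrow> bool" where
  "log_branch f L \<longleftrightarrow> L holomorphic_on unit_disc \<and> L 0 = 0 \<and>
     (\<forall>z \<in> unit_disc - {0}. exp (L z) = f z / z)"

text \<open>The branch exists and is unique on the disc; see \<open>log_branch_exists\<close> and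
  \<open>log_coeff_sums\<close> below.\<close>

definition log_coeff :: "(complex \<Rightarrow> complex) \<Rightarrow> nat \<Rightarrow> complex" where
  "log_coeff f n = taylor_coeff (SOME L. log_branch f L) n / 2"

definition schwarz_function :: "(complex \<Rightarrow> complex) \<Rightarrow> bool" where
  "schwarz_function \<omega> \<longleftrightarrow>
     \<omega> holomorphic_on unit_disc \<and> \<omega> ` unit_disc \<subseteq> unit_disc \<and> \<omega> 0 = 0"

definition subordinate :: "(complex \<Rightarrow> complex) \<Rightarrow> (complex \<Rightarrow> complex) \<Rightarrow> bool"  (infix "\<prec>\<^sub>s" 50) where
  "g \<prec>\<^sub>s h \<longleftrightarrow> (\<exists>\<omega>. schwarz_function \<omega> \<and> (\<forall>z \<in> unit_disc. g z = h (\<omega> z)))"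

text \<open>Starlikeness is required with respect to the specific point \<open>1\<close>, whereas the library's
  \<^const>\<open>starlike\<close> leaves the centre existentially quantified.\<close>

definition ma_minda :: "(complex \<Rightarrow> complex) \<Rightarrow> bool" where
  "ma_minda \<phi> \<longleftrightarrow>
     \<phi> holomorphic_on unit_disc \<and> inj_on \<phi> unit_disc \<and>
     (\<forall>z \<in> unit_disc. Re (\<phi> z) > 0) \<and>
     \<phi> 0 = 1 \<and> deriv \<phi> 0 \<in> \<real> \<and> Re (deriv \<phi> 0) > 0 \<and>
     cnj ` (\<phi> ` unit_disc) = \<phi> ` unit_disc \<and>
     (\<forall>w \<in> \<phi> ` unit_disc. closed_segment 1 w \<subseteq> \<phi> ` unit_disc)"

text \<open>The Taylor coefficients of a Ma--Minda function are real, so taking the real part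
  loses nothing; see \<open>ma_minda_taylor_coeff\<close> below.\<close>

definition mm_coeff :: "(complex \<Rightarrow> complex) \<Rightarrow> nat \<Rightarrow> real" where
  "mm_coeff \<phi> n = Re (taylor_coeff \<phi> n)"

text \<open>The value \<open>1\<close> at the origin is the removable singularity of \<open>z f'(z) / f(z)\<close>.\<close>

definition starlike_quotient :: "(complex \<Rightarrow> complex) \<Rightarrow> complex \<Rightarrow> complex" where
  "starlike_quotient f z = (if z = 0 then 1 else z * deriv f z / f z)"

definition S_star :: "(complex \<Rightarrow> complex) \<Rightarrow> (complex \<Rightarrow> complex) set" where
  "S_star \<phi> = {f \<in> class_S. starlike_quotient f \<prec>\<^sub>s \<phi>}"

definition D1 :: "(real \<times> real) set" where
  "D1 = {(\<mu>, \<nu>). \<bar>\<mu>\<bar> \<le> 2 \<and> \<nu> \<ge> 1}"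

definition D2 :: "(real \<times> real) set" where
  "D2 = {(\<mu>, \<nu>). 2 \<le> \<bar>\<mu>\<bar> \<and> \<bar>\<mu>\<bar> \<le> 4 \<and> \<nu> \<ge> 1 / 12 * (\<mu>\<^sup>2 + 8)}"

definition D3 :: "(real \<times> real) set" where
  "D3 = {(\<mu>, \<nu>). \<bar>\<mu>\<bar> \<ge> 4 \<and> \<nu> \<ge> 2 / 3 * (\<bar>\<mu>\<bar> - 1)}"

lemma log_branch_exists:
  assumes "f \<in> class_S"
  shows "\<exists>L. log_branch f L"
proof -
  have f: "f holomorphic_on unit_disc" "inj_on f unit_disc" "f 0 = 0" "deriv f 0 = 1"
    using assms by (auto simp: class_S_def)
  define q where "q = (\<lambda>z. if z = 0 then deriv f 0 else (f z - f 0) / (z - 0))"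
  have hq: "q holomorphic_on unit_disc"
    unfolding q_def by (rule pole_lemma_open) (use f in auto)
  have nz: "q z \<noteq> 0" if "z \<in> unit_disc" for z
    using inj_onD[OF f(2), of z 0] that f by (auto simp: q_def)
  obtain g where g: "g holomorphic_on unit_disc" "\<And>z. z \<in> unit_disc \<Longrightarrow> q z = exp (g z)"
    using contractible_imp_holomorphic_log[OF hq convex_imp_contractible[OF convex_ball] nz]
    by metis
  have "exp (g 0) = 1"
    using g(2)[of 0] f by (simp add: q_def)
  then have "log_branch f (\<lambda>z. g z - g 0)"
    unfolding log_branch_def using g f
    by (auto intro!: holomorphic_intros simp: exp_diff q_def simp flip: g(2))
  then show ?thesis by blast
qed

lemma log_branch_unique:
  assumes f: "f \<in> class_S" and L: "log_branch f L" and M: "log_branch f M" and z: "z \<in> unit_disc"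
  shows "L z = M z"
proof -
  define h where "h = (\<lambda>z. L z - M z)"
  have hol: "L holomorphic_on unit_disc" "M holomorphic_on unit_disc"
    using L M by (auto simp: log_branch_def)
  then have h: "h holomorphic_on unit_disc"
    unfolding h_def by (intro holomorphic_intros)
  have e: "exp (h w) = 1" if "w \<in> unit_disc" for w
  proof (cases "w = 0")
    case True
    then show ?thesis using L M by (simp add: h_def log_branch_def)
  next
    case False
    then have "exp (L w) = exp (M w)"
      using L M that by (simp add: log_branch_def)
    then show ?thesis by (simp add: h_def exp_diff)
  qed
  have "h constant_on unit_disc"
  proof (rule continuous_discrete_range_constant)
    show "continuous_on unit_disc h"
      using h holomorphic_on_imp_continuous_on by blast
    show "\<exists>e>0. \<forall>y. y \<in> unit_disc \<and> h y \<noteq> h x \<longrightarrow> e \<le> norm (h y - h x)"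
      if x: "x \<in> unit_disc" for x
    proof (intro exI[of _ 1] conjI allI impI, simp)
      fix y assume y: "y \<in> unit_disc \<and> h y \<noteq> h x"
      then obtain n where n: "h y = h x + (of_int (2 * n) * pi) * \<i>"
        using e[of x] e[of y] x exp_eq[of "h y" "h x"] by auto
      with y have "n \<noteq> 0" by auto
      then have "1 \<le> \<bar>real_of_int n\<bar>" by linarith
      moreover have "norm (h y - h x) = 2 * \<bar>real_of_int n\<bar> * pi"
        by (simp add: n norm_mult)
      ultimately show "1 \<le> norm (h y - h x)"
        using mult_mono[of 1 "\<bar>real_of_int n\<bar>" 1 pi] pi_gt3 by (simp add: mult.assoc)
    qed
  qed simp
  then obtain c where "\<And>w. w \<in> unit_disc \<Longrightarrow> h w = c"
    by (auto simp: constant_on_def)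
  from this[of 0] this[OF z] show ?thesis
    using L M by (simp add: h_def log_branch_def)
qed

lemma log_coeff_sums:
  assumes f: "f \<in> class_S" and L: "log_branch f L" and z: "z \<in> unit_disc"
  shows "(\<lambda>n. 2 * log_coeff f (Suc n) * z ^ Suc n) sums L z"
proof -
  define M where "M = (SOME L. log_branch f L)"
  have M: "log_branch f M"
    unfolding M_def using log_branch_exists[OF f] by (rule someI_ex)
  then have "(\<lambda>n. taylor_coeff M n * z ^ n) sums M z"
    by (intro taylor_coeff_sums z) (simp add: log_branch_def)
  moreover have "taylor_coeff M 0 = 0"
    using M by (simp add: taylor_coeff_def log_branch_def)
  ultimately have "(\<lambda>n. taylor_coeff M (Suc n) * z ^ Suc n) sums M z"
    by (subst sums_Suc_iff) simp
  then show ?thesis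
    using log_branch_unique[OF f L M z] by (simp add: log_coeff_def M_def)
qed

lemma ma_minda_cnj:
  assumes mm: "ma_minda \<phi>" and z: "z \<in> unit_disc"
  shows "\<phi> (cnj z) = cnj (\<phi> z)"
proof -
  have hol: "\<phi> holomorphic_on unit_disc" and inj: "inj_on \<phi> unit_disc"
    and p0: "\<phi> 0 = 1" and dR: "deriv \<phi> 0 \<in> \<real>" and dpos: "Re (deriv \<phi> 0) > 0"
    and sym: "cnj ` (\<phi> ` unit_disc) = \<phi> ` unit_disc"
    using mm by (auto simp: ma_minda_def)
  obtain g where g: "g holomorphic_on (\<phi> ` unit_disc)"
      "\<And>z. z \<in> unit_disc \<Longrightarrow> deriv \<phi> z * deriv g (\<phi> z) = 1"
      "\<And>z. z \<in> unit_disc \<Longrightarrow> g (\<phi> z) = z"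
    using holomorphic_has_inverse[OF hol open_ball inj] by metis
  define \<psi> where "\<psi> = (\<lambda>z. cnj (\<phi> (cnj z)))"
  have \<psi>hol: "\<psi> holomorphic_on unit_disc"
    unfolding \<psi>_def holomorphic_on_open[OF open_ball]
  proof
    fix z :: complex assume "z \<in> unit_disc"
    then have "(\<phi> has_field_derivative deriv \<phi> (cnj z)) (at (cnj z))"
      by (intro holomorphic_derivI[OF hol]) auto
    from has_field_derivative_cnj_cnj[OF this]
    show "\<exists>f'. ((\<lambda>z. cnj (\<phi> (cnj z))) has_field_derivative f') (at z)"
      by (auto simp: o_def)
  qed
  have \<psi>in: "\<psi> w \<in> \<phi> ` unit_disc" if "w \<in> unit_disc" for w
    using that sym unfolding \<psi>_def by (metis complex_mod_cnj image_eqI mem_ball_0)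
  define h where "h = (\<lambda>z. g (\<psi> z))"
  have hhol: "h holomorphic_on unit_disc"
    using holomorphic_on_compose_gen[OF \<psi>hol g(1)] \<psi>in unfolding h_def o_def by blast
  have h0: "h 0 = 0"
    using g(3)[of 0] by (simp add: h_def \<psi>_def p0)
  have hin: "norm (h w) < 1" if "norm w < 1" for w
    using \<psi>in[of w] that g(3) by (auto simp: h_def)
  have oi: "open (\<phi> ` unit_disc)"
    using open_mapping_thm3[OF hol open_ball inj] .
  have d\<psi>: "(\<psi> has_field_derivative deriv \<phi> 0) (at 0)"
  proof -
    have "(\<phi> has_field_derivative deriv \<phi> 0) (at (cnj 0))"
      using holomorphic_derivI[OF hol] by simp
    from has_field_derivative_cnj_cnj[OF this] show ?thesis
      using dR by (simp add: \<psi>_def o_def Reals_cnj_iff)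
  qed
  have "(g has_field_derivative deriv g 1) (at 1)"
    by (rule holomorphic_derivI[OF g(1) oi]) (use p0 in force)
  then have "(g has_field_derivative deriv g 1) (at (\<psi> 0))"
    by (simp add: \<psi>_def p0)
  from DERIV_chain2[OF this d\<psi>] have "(h has_field_derivative 1) (at 0)"
    using g(2)[of 0] by (simp add: h_def p0 mult.commute)
  note dh = this
  then have "norm (deriv h 0) = 1"
    by (simp add: DERIV_imp_deriv)
  then obtain \<alpha> where \<alpha>: "\<And>z. norm z < 1 \<Longrightarrow> h z = \<alpha> * z"
    using Schwarz_Lemma(3)[OF hhol h0 hin, of 0] by auto
  have "(h has_field_derivative \<alpha>) (at 0)"
    by (rule has_field_derivative_transform_within_open[where f = "\<lambda>z. \<alpha> * z" and S = unit_disc])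
       (auto intro!: derivative_eq_intros simp: \<alpha>)
  then have "\<alpha> = 1"
    using dh DERIV_unique by blast
  then have "g (\<psi> z) = z"
    using \<alpha>[of z] z by (simp add: h_def)
  moreover obtain w where w: "w \<in> unit_disc" "\<psi> z = \<phi> w"
    using \<psi>in[OF z] by blast
  ultimately have "\<psi> z = \<phi> z"
    using g(3)[of w] by simp
  then show ?thesis
    unfolding \<psi>_def by (metis complex_cnj_cnj)
qed

lemma ma_minda_taylor_coeff:
  assumes mm: "ma_minda \<phi>"
  shows "taylor_coeff \<phi> n = of_real (mm_coeff \<phi> n)"
proof -
  have hol: "\<phi> holomorphic_on unit_disc"
    using mm by (auto simp: ma_minda_def)
  have "(deriv ^^ n) \<phi> (cnj z) = cnj ((deriv ^^ n) \<phi> z)" if "z \<in> unit_disc" for z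
    using that
  proof (induction n arbitrary: z)
    case 0
    then show ?case using ma_minda_cnj[OF mm] by simp
  next
    case (Suc n)
    let ?d = "(deriv ^^ n) \<phi>"
    have hd: "?d holomorphic_on unit_disc"
      by (intro holomorphic_higher_deriv hol open_ball)
    have "(?d has_field_derivative deriv ?d (cnj z)) (at (cnj z))"
      using Suc.prems by (intro holomorphic_derivI[OF hd]) auto
    from has_field_derivative_cnj_cnj[OF this]
    have "((cnj \<circ> ?d \<circ> cnj) has_field_derivative cnj (deriv ?d (cnj z))) (at z)"
      by simp
    then have "(?d has_field_derivative cnj (deriv ?d (cnj z))) (at z)"
      by (rule has_field_derivative_transform_within_open[where S = unit_disc])
         (use Suc in auto)
    then show ?case
      by (simp add: DERIV_imp_deriv)
  qed
  from this[of 0] have "(deriv ^^ n) \<phi> 0 \<in> \<real>"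
    by (simp add: Reals_cnj_iff)
  then have "taylor_coeff \<phi> n \<in> \<real>"
    unfolding taylor_coeff_def
    by (metis Reals_divide Reals_of_nat of_nat_fact)
  then show ?thesis
    by (simp add: mm_coeff_def)
qed

end

theory Submission
  imports Defs
begin

text \<open>Differentiating the defining relation of the logarithmic coefficients gives
  \<open>2 n \<gamma>\<^sub>n\<close> as the \<open>n\<close>-th coefficient of \<open>\<phi> \<circ> \<omega>\<close>. With \<open>\<omega> = c\<^sub>1 z + c\<^sub>2 z^2 + \<dots>\<close> this reads
  \<open>4 \<gamma>\<^sub>2 = B\<^sub>1 c\<^sub>2 + B\<^sub>2 c\<^sub>1^2\<close> and \<open>6 \<gamma>\<^sub>3 = B\<^sub>1 (c\<^sub>3 + \<mu>\<^sub>1 c\<^sub>1 c\<^sub>2 + \<nu>\<^sub>1 c\<^sub>1^3)\<close>. The first is at most \<open>\<bar>B\<^sub>2\<bar>\<close> by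
  \<open>\<bar>c\<^sub>2\<bar> \<le> 1 - \<bar>c\<^sub>1\<bar>^2\<close>, the second at most \<open>B\<^sub>3\<close> by an inequality of Prokhorov and Szynal, which follows from
  the Schur parametrisation of \<open>c\<^sub>1, c\<^sub>2, c\<^sub>3\<close>. The triangle inequality gives the bound, and \<open>\<omega>(z) = \<i> z\<close>
  gives equality because then \<open>\<gamma>\<^sub>2^2 \<ge> 0\<close> and \<open>\<gamma>\<^sub>3^2 \<le> 0\<close>.\<close>

section \<open>Schwarz functions\<close>

text \<open>By the maximum modulus principle, a value of modulus 1 inside the disc forces constancy.
  The split isolates the constants, for which the Moebius map of \<open>Schur_step\<close> may be
  undefined.\<close>

lemma bounded_by_one_cases:
  assumes hol: "g holomorphic_on unit_disc" and le: "\<And>z. z \<in> unit_disc \<Longrightarrow> norm (g z) \<le> 1"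
  obtains "\<forall>z\<in>unit_disc. norm (g z) < 1" | c where "\<forall>z\<in>unit_disc. g z = c"
proof (cases "\<exists>z0\<in>unit_disc. norm (g z0) = 1")
  case True
  then obtain z0 where z0: "z0 \<in> unit_disc" "norm (g z0) = 1" by blast
  have "g constant_on unit_disc"
    by (rule maximum_modulus_principle[OF hol, where U = unit_disc and \<xi> = z0])
      (use z0 le in auto)
  then show ?thesis using that(2) by (auto simp: constant_on_def)
next
  case False
  then show ?thesis using that(1) le by (metis less_eq_real_def)
qed

text \<open>The Schwarz lemma bounds \<open>f z / z\<close> off the origin and
  \<open>deriv f 0\<close> at it. The bound on \<open>h\<close> cannot be strict: a rotation has a
  unimodular constant as quotient.\<close>

lemma Schwarz_quotient:
  assumes hol: "f holomorphic_on unit_disc" and f0: "f 0 = 0"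
    and less: "\<And>z. z \<in> unit_disc \<Longrightarrow> norm (f z) < 1"
  obtains h where "h holomorphic_on unit_disc" "\<And>z. z \<in> unit_disc \<Longrightarrow> norm (h z) \<le> 1"
    "\<And>z. z \<in> unit_disc \<Longrightarrow> f z = z * h z"
proof -
  obtain h where h: "h holomorphic_on unit_disc" "\<And>z. norm z < 1 \<Longrightarrow> f z = z * h z" "deriv f 0 = h 0"
    using Schwarz3[OF hol f0] by metis
  have "norm (h z) \<le> 1" if z: "z \<in> unit_disc" for z
  proof (cases "z = 0")
    case True
    then show ?thesis using Schwarz_Lemma(2)[OF hol f0, of 0] less h(3) by simp
  next
    case False
    have "norm z * norm (h z) \<le> norm z"
      using Schwarz_Lemma(1)[OF hol f0, of z] less z h(2)[of z] by (simp add: norm_mult)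
    then show ?thesis using False by simp
  qed
  then show ?thesis using h that by (metis mem_ball_0)
qed

text \<open>One step of the Schur algorithm: the Moebius map sending \<open>g 0\<close> to 0,
  composed with \<open>g\<close>, vanishes at the origin and so equals \<open>z * h z\<close>.
  Clearing the denominator leaves a relation that turns directly into an identity of power
  series.\<close>

lemma Schur_step:
  assumes hol: "g holomorphic_on unit_disc"
    and less: "\<And>z. z \<in> unit_disc \<Longrightarrow> norm (g z) < 1"
  obtains h where "h holomorphic_on unit_disc" "\<And>z. z \<in> unit_disc \<Longrightarrow> norm (h z) \<le> 1"
    "\<And>z. z \<in> unit_disc \<Longrightarrow> g z * (1 + cnj (g 0) * (z * h z)) = g 0 + z * h z"
proof -
  define a where "a = g 0"
  have a: "norm a < 1" using less by (simp add: a_def)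
  define M where "M = Moebius_function 0 a \<circ> g"
  have "M holomorphic_on unit_disc"
    unfolding M_def
    by (rule holomorphic_on_compose_gen[OF hol Moebius_function_holomorphic[OF a]])
      (use less in auto)
  moreover have "M 0 = 0"
    by (simp add: M_def a_def Moebius_function_def)
  moreover have "norm (M z) < 1" if "z \<in> unit_disc" for z
    using Moebius_function_norm_lt_1[OF a less[OF that]] by (simp add: M_def)
  ultimately obtain h where h: "h holomorphic_on unit_disc"
      "\<And>z. z \<in> unit_disc \<Longrightarrow> norm (h z) \<le> 1" "\<And>z. z \<in> unit_disc \<Longrightarrow> M z = z * h z"
    using Schwarz_quotient by metis
  have "g z * (1 + cnj (g 0) * (z * h z)) = g 0 + z * h z" if z: "z \<in> unit_disc" for z
  proof -
    have "norm (cnj a * g z) < 1"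
      using mult_strict_mono'[of "norm a" 1 "norm (g z)" 1] a less[OF z] by (simp add: norm_mult)
    then have "1 - cnj a * g z \<noteq> 0" by auto
    moreover have "z * h z = (g z - a) / (1 - cnj a * g z)"
      using h(3)[OF z] by (simp add: M_def Moebius_function_def)
    ultimately show ?thesis
      by (simp add: a_def[symmetric] field_simps)
  qed
  then show ?thesis using h that by blast
qed

section \<open>Taylor coefficients via formal power series\<close>

lemma taylor_coeff_expansion:
  assumes "f holomorphic_on unit_disc"
  shows "f has_fps_expansion Abs_fps (taylor_coeff f)"
proof -
  have "f has_fps_expansion fps_expansion f 0"
    using assms by (intro has_fps_expansion_fps_expansion[of unit_disc]) auto
  then show ?thesis
    by (simp add: fps_expansion_def taylor_coeff_def[abs_def])
qed

lemma has_fps_expansion_unique_on_disc: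
  fixes f g :: "complex \<Rightarrow> complex"
  assumes "f has_fps_expansion F" "g has_fps_expansion G"
    and eq: "\<And>z. z \<in> unit_disc \<Longrightarrow> f z = g z"
  shows "F = G"
proof -
  have "eventually (\<lambda>z. z \<in> unit_disc) (nhds (0::complex))"
    by (intro eventually_nhds_in_open) auto
  then have "eventually (\<lambda>z. f z = g z) (nhds 0)"
    by eventually_elim (rule eq)
  then have "g has_fps_expansion F"
    using assms(1) has_fps_expansion_cong by blast
  then show ?thesis
    using assms(2) fps_expansion_unique_complex by blast
qed

text \<open>Schwarz-Pick at the origin: the linear coefficient of the Schur relation is
  \<open>h 0 * (1 - g 0 * cnj (g 0))\<close> with \<open>norm (h 0) \<le> 1\<close>. For constant
  \<open>g\<close> it is 0.\<close>

lemma norm_taylor_coeff_1_le: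
  assumes hol: "g holomorphic_on unit_disc" and le: "\<And>z. z \<in> unit_disc \<Longrightarrow> norm (g z) \<le> 1"
  shows "norm (taylor_coeff g 1) \<le> 1 - (norm (taylor_coeff g 0))\<^sup>2"
proof -
  consider "\<forall>z\<in>unit_disc. norm (g z) < 1" | c where "\<forall>z\<in>unit_disc. g z = c"
    using bounded_by_one_cases[OF hol] le by blast
  then show ?thesis
  proof cases
    case 1
    then have less: "norm (g z) < 1" if "z \<in> unit_disc" for z using that by blast
    from Schur_step[OF hol less] obtain h where h: "h holomorphic_on unit_disc"
        "\<And>z. z \<in> unit_disc \<Longrightarrow> norm (h z) \<le> 1"
        "\<And>z. z \<in> unit_disc \<Longrightarrow> g z * (1 + cnj (g 0) * (z * h z)) = g 0 + z * h z"
      by metis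
    define G where "G = Abs_fps (taylor_coeff g)"
    define H where "H = Abs_fps (taylor_coeff h)"
    have G: "g has_fps_expansion G" and H: "h has_fps_expansion H"
      unfolding G_def H_def using taylor_coeff_expansion hol h by auto
    have "G * (1 + fps_const (cnj (g 0)) * (fps_X * H)) = fps_const (g 0) + fps_X * H"
      by (rule has_fps_expansion_unique_on_disc[of "\<lambda>z. g z * (1 + cnj (g 0) * (z * h z))" _
            "\<lambda>z. g 0 + z * h z"]; (intro fps_expansion_intros G H)?) (rule h(3))
    then have "(G * (1 + fps_const (cnj (g 0)) * (fps_X * H))) $ 1 = (fps_const (g 0) + fps_X * H) $ 1"
      by simp
    then have "taylor_coeff g 1 = h 0 * (1 - g 0 * cnj (g 0))"
      by (simp add: fps_mult_nth G_def H_def taylor_coeff_def algebra_simps)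
    also have "1 - g 0 * cnj (g 0) = of_real (1 - (norm (g 0))\<^sup>2)"
      by (simp add: complex_norm_square[symmetric])
    finally have "norm (taylor_coeff g 1) = norm (h 0) * \<bar>1 - (norm (g 0))\<^sup>2\<bar>"
      by (simp add: norm_mult del: of_real_diff)
    also have "\<dots> \<le> 1 * \<bar>1 - (norm (g 0))\<^sup>2\<bar>"
      using h(2)[of 0] by (intro mult_right_mono) auto
    also have "\<dots> = 1 - (norm (g 0))\<^sup>2"
      using le[of 0] by (simp add: abs_square_le_1 power_le_one)
    finally show ?thesis by (simp add: taylor_coeff_def)
  next
    case (2 c)
    then have eq: "g z = c" if "z \<in> unit_disc" for z using that by blast
    have "Abs_fps (taylor_coeff g) = fps_const c"
      by (rule has_fps_expansion_unique_on_disc[of g _ "\<lambda>_. c"]) (auto intro: taylor_coeff_expansion hol eq)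
    from arg_cong[OF this, of "\<lambda>F. fps_nth F 1"] have "taylor_coeff g 1 = 0" by simp
    then show ?thesis using le[of 0] by (simp add: taylor_coeff_def power_le_one)
  qed
qed

text \<open>Write \<open>\<omega> z = z * g z\<close> and apply one Schur step to \<open>g\<close>.
  Then \<open>w\<close> and \<open>w'\<close> are the first two Taylor coefficients of the resulting
  \<open>h\<close>, and the bound on \<open>w'\<close> is Schwarz-Pick for \<open>h\<close>.\<close>

lemma schwarz_coefficients:
  assumes "schwarz_function \<omega>"
  obtains w w' where
    "norm (taylor_coeff \<omega> 1) \<le> 1" "norm w \<le> 1" "norm w' \<le> 1 - (norm w)\<^sup>2"
    "taylor_coeff \<omega> 2 = of_real (1 - (norm (taylor_coeff \<omega> 1))\<^sup>2) * w"
    "taylor_coeff \<omega> 3 =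
       of_real (1 - (norm (taylor_coeff \<omega> 1))\<^sup>2) * (w' - cnj (taylor_coeff \<omega> 1) * w\<^sup>2)"
proof -
  have \<omega>: "\<omega> holomorphic_on unit_disc" "\<omega> 0 = 0" "\<And>z. z \<in> unit_disc \<Longrightarrow> norm (\<omega> z) < 1"
    using assms by (auto simp: schwarz_function_def image_subset_iff)
  from Schwarz_quotient[OF \<omega>] obtain g where g: "g holomorphic_on unit_disc"
      "\<And>z. z \<in> unit_disc \<Longrightarrow> norm (g z) \<le> 1" "\<And>z. z \<in> unit_disc \<Longrightarrow> \<omega> z = z * g z"
    by metis
  define G where "G = Abs_fps (taylor_coeff g)"
  have G: "g has_fps_expansion G"
    unfolding G_def using taylor_coeff_expansion g by auto
  have "Abs_fps (taylor_coeff \<omega>) = fps_X * G"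
    by (rule has_fps_expansion_unique_on_disc[of \<omega> _ "\<lambda>z. z * g z"];
        (intro fps_expansion_intros G taylor_coeff_expansion \<omega>)?) (rule g(3))
  from arg_cong[OF this, of "\<lambda>F. fps_nth F (Suc n)" for n]
  have c: "taylor_coeff \<omega> (Suc n) = G $ n" for n
    by simp
  have c1: "taylor_coeff \<omega> 1 = g 0"
    using c[of 0] by (simp add: G_def taylor_coeff_def)
  have c23: "taylor_coeff \<omega> 2 = G $ 1" "taylor_coeff \<omega> 3 = G $ 2"
    using c[of 1] c[of 2] by (simp_all add: numeral_2_eq_2 numeral_3_eq_3)
  consider "\<forall>z\<in>unit_disc. norm (g z) < 1" | c where "\<forall>z\<in>unit_disc. g z = c"
    using bounded_by_one_cases[OF g(1)] g(2) by blast
  then show ?thesis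
  proof cases
    case 1
    then have less: "norm (g z) < 1" if "z \<in> unit_disc" for z using that by blast
    from Schur_step[OF g(1) less] obtain h where h: "h holomorphic_on unit_disc"
        "\<And>z. z \<in> unit_disc \<Longrightarrow> norm (h z) \<le> 1"
        "\<And>z. z \<in> unit_disc \<Longrightarrow> g z * (1 + cnj (g 0) * (z * h z)) = g 0 + z * h z"
      by metis
    define H where "H = Abs_fps (taylor_coeff h)"
    have H: "h has_fps_expansion H"
      unfolding H_def using taylor_coeff_expansion h by auto
    have G0: "G $ 0 = g 0"
      by (simp add: G_def taylor_coeff_def)
    have E: "G * (1 + fps_const (cnj (g 0)) * (fps_X * H)) = fps_const (g 0) + fps_X * H"
      by (rule has_fps_expansion_unique_on_disc[of "\<lambda>z. g z * (1 + cnj (g 0) * (z * h z))" _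
          "\<lambda>z. g 0 + z * h z"]; (intro fps_expansion_intros G H)?) (rule h(3))
    have e1: "G $ 1 + g 0 * cnj (g 0) * H $ 0 = H $ 0"
      using arg_cong[OF E, of "\<lambda>F. fps_nth F 1"] by (simp add: fps_mult_nth G0 algebra_simps)
    have e2: "G $ 2 + g 0 * cnj (g 0) * H $ 1 + cnj (g 0) * G $ 1 * H $ 0 = H $ 1"
      using arg_cong[OF E, of "\<lambda>F. fps_nth F 2"]
      by (simp add: fps_mult_nth G0 algebra_simps numeral_2_eq_2)
    have n: "of_real (1 - (norm (g 0))\<^sup>2) = 1 - g 0 * cnj (g 0)"
      by (simp add: complex_norm_square[symmetric])
    show ?thesis
    proof (rule that[of "H $ 0" "H $ 1"])
      show "norm (taylor_coeff \<omega> 1) \<le> 1" using g(2)[of 0] c1 by simp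
      show "norm (H $ 0) \<le> 1"
        using h(2)[of 0] by (simp add: H_def taylor_coeff_def)
      show "norm (H $ 1) \<le> 1 - (norm (H $ 0))\<^sup>2"
        using norm_taylor_coeff_1_le[OF h(1,2)] by (simp add: H_def)
      show "taylor_coeff \<omega> 2 = of_real (1 - (norm (taylor_coeff \<omega> 1))\<^sup>2) * H $ 0"
        unfolding c1 n c23 using e1 by (simp add: algebra_simps)
      \<comment> \<open>Inserted into the cross term \<open>cnj (g 0) * G $ 1 * H $ 0\<close>, this
        yields the term quadratic in \<open>H $ 0\<close> and lets
        \<open>1 - g 0 * cnj (g 0)\<close> be factored out.\<close>
      have G1: "G $ 1 = (1 - g 0 * cnj (g 0)) * H $ 0"
        using e1 by (simp add: algebra_simps)
      have "G $ 2 = H $ 1 - g 0 * cnj (g 0) * H $ 1 - cnj (g 0) * G $ 1 * H $ 0"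
        using e2 by (simp add: eq_diff_eq algebra_simps)
      then have "G $ 2 = (1 - g 0 * cnj (g 0)) * (H $ 1 - cnj (g 0) * (H $ 0)\<^sup>2)"
        unfolding G1 by (simp add: algebra_simps power2_eq_square)
      then show "taylor_coeff \<omega> 3 = of_real (1 - (norm (taylor_coeff \<omega> 1))\<^sup>2) *
          (H $ 1 - cnj (taylor_coeff \<omega> 1) * (H $ 0)\<^sup>2)"
        unfolding c1 n c23 .
    qed
  next
    case (2 c)
    then have eq: "g z = c" if "z \<in> unit_disc" for z using that by blast
    have "G = fps_const c"
      by (rule has_fps_expansion_unique_on_disc[of g _ "\<lambda>_. c"]) (auto intro: G eq)
    then have G12: "G $ 1 = 0" "G $ 2 = 0" by auto
    show ?thesis
      \<comment> \<open>For constant \<open>g\<close> the second and third coefficients of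
        \<open>\<omega>\<close> vanish, so zero parameters represent them.\<close>
      by (rule that[of 0 0]) (use g(2)[of 0] c1 c23 G12 in auto)
  qed
qed

section \<open>The third coefficient functional\<close>

text \<open>The maximum of \<open>norm Z\<close> over \<open>Re w\<close> for fixed \<open>norm w\<close> is found by completing the square:
  the defect is the square subtracted in the identity below. The hypothesis \<open>(\<mu>\<^sup>2 + 8) / 12 \<le> \<nu>\<close> is
  what remains after \<open>sqrt (1 + 2 d) \<le> 1 + d\<close>.\<close>

lemma rotated_third_coefficient_bound:
  fixes \<mu> \<nu> x :: real and w :: complex
  assumes x: "0 \<le> x" "x \<le> 1" and \<nu>: "1 \<le> \<nu>" "(\<mu>\<^sup>2 + 8) / 12 \<le> \<nu>" and w: "norm w \<le> 1"
  shows "x * norm (\<nu> * x\<^sup>2 + (1 - x\<^sup>2) * (\<mu> * w - w\<^sup>2)) + (1 - x\<^sup>2) * (1 - (norm w)\<^sup>2) \<le> \<nu>"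
proof -
  define t s q Z where "t = x\<^sup>2" and "s = 1 - x\<^sup>2" and "q = (norm w)\<^sup>2"
    and "Z = of_real \<nu> * of_real t + of_real s * (of_real \<mu> * w - w\<^sup>2)"
  have ts: "0 \<le> t" "0 \<le> s" "t + s = 1" and q: "0 \<le> q" "q \<le> 1"
    using x w by (auto simp: t_def s_def q_def power_le_one)
  define P where "P = \<nu> * t + s * q"
  have P: "0 \<le> P" "P \<le> \<nu>"
  proof -
    show "0 \<le> P" using ts q \<nu> by (simp add: P_def)
    have "s * q \<le> s * \<nu>" using ts q \<nu> by (intro mult_left_mono) auto
    then have "P \<le> \<nu> * (t + s)" by (simp add: P_def algebra_simps)
    then show "P \<le> \<nu>" using ts by simp
  qed
  \<comment> \<open>For fixed \<open>q\<close>, the square of \<open>norm Z\<close> is quadratic in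
    \<open>Re w\<close>. What is left after completing the square is a multiple of
    \<open>P\<^sup>2\<close> because
    \<open>(\<nu> * t - s * q)^2 + 4 * \<nu> * t * s * q = P^2\<close>.\<close>
  have "t * norm Z ^ 2 * (4 * \<nu>) =
      (4 * \<nu> * t + \<mu>\<^sup>2 * s) * P\<^sup>2 - s * (4 * \<nu> * t * Re w - \<mu> * (\<nu> * t - s * q))\<^sup>2"
    unfolding P_def q_def Z_def cmod_power2
    by (simp add: power2_eq_square algebra_simps)
  also have "\<dots> \<le> (4 * \<nu> * t + \<mu>\<^sup>2 * s) * P\<^sup>2"
    using ts by simp
  also have "\<dots> \<le> (4 * \<nu> + 8 * (\<nu> - 1) * s) * P\<^sup>2"
  proof (intro mult_right_mono)
    have "\<mu>\<^sup>2 * s \<le> (12 * \<nu> - 8) * s"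
      using \<nu> ts by (intro mult_right_mono) auto
    moreover have "4 * \<nu> * t = 4 * \<nu> - 4 * \<nu> * s"
      by (simp add: t_def s_def algebra_simps)
    ultimately show "4 * \<nu> * t + \<mu>\<^sup>2 * s \<le> 4 * \<nu> + 8 * (\<nu> - 1) * s"
      by (simp add: algebra_simps)
  qed simp
  also have "\<dots> = (4 * \<nu>) * ((1 + 2 * ((\<nu> - 1) * s / \<nu>)) * P\<^sup>2)"
    using \<nu> by (simp add: field_simps)
  finally have "t * (norm Z)\<^sup>2 \<le> (1 + 2 * ((\<nu> - 1) * s / \<nu>)) * P\<^sup>2"
    using \<nu> by (simp add: mult.commute)
  also have "\<dots> \<le> ((1 + (\<nu> - 1) * s / \<nu>) * P)\<^sup>2"
  proof -
    have "1 + 2 * d \<le> (1 + d)\<^sup>2" for d :: real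
      by (simp add: power2_sum)
    then show ?thesis
      unfolding power_mult_distrib by (intro mult_right_mono zero_le_power2)
  qed
  finally have "(x * norm Z)\<^sup>2 \<le> ((1 + (\<nu> - 1) * s / \<nu>) * P)\<^sup>2"
    by (simp add: t_def power_mult_distrib)
  then have "x * norm Z \<le> (1 + (\<nu> - 1) * s / \<nu>) * P"
    by (rule power2_le_imp_le) (use P \<nu> ts in simp)
  also have "\<dots> = P + (\<nu> - 1) * s * (P / \<nu>)"
    using \<nu> by (simp add: field_simps)
  \<comment> \<open>Bounding \<open>P / \<nu>\<close> by 1 leaves
    \<open>\<nu> - s * (1 - q)\<close>, exactly the room that the second summand of the claim takes
    up.\<close>
  also have "\<dots> \<le> P + (\<nu> - 1) * s * 1"
    using P \<nu> ts by (intro add_left_mono mult_left_mono) auto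
  also have "\<dots> = \<nu> - s * (1 - q)"
    using ts(3) by (simp add: P_def algebra_simps eq_diff_eq flip: distrib_left)
  finally show ?thesis
    by (simp add: Z_def t_def s_def q_def)
qed

text \<open>A rotation reduces to \<open>c \<ge> 0\<close>: with \<open>c = x * e\<close>,
  \<open>norm e = 1\<close> and \<open>w = e ^ 2 * W\<close>, all terms free of \<open>w'\<close>
  share the factor \<open>e ^ 3\<close>. Since \<open>w'\<close> is controlled by its modulus alone,
  \<open>rotated_third_coefficient_bound\<close> for \<open>W\<close> finishes the estimate.\<close>

lemma third_coefficient_bound_parabola:
  fixes \<mu> \<nu> :: real and c w w' :: complex
  assumes c: "norm c \<le> 1" and w: "norm w \<le> 1" "norm w' \<le> 1 - (norm w)\<^sup>2"
    and \<nu>: "1 \<le> \<nu>" "(\<mu>\<^sup>2 + 8) / 12 \<le> \<nu>"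
  shows "norm ((1 - (norm c)\<^sup>2) * (w' - cnj c * w\<^sup>2) + \<mu> * (c * ((1 - (norm c)\<^sup>2) * w)) + \<nu> * c ^ 3)
    \<le> \<nu>"
proof -
  define x where "x = norm c"
  have x0: "0 \<le> x" by (simp add: x_def)
  obtain e where e: "c = of_real x * e" "norm e = 1"
  proof (cases "c = 0")
    case True
    then show ?thesis using that[of 1] by (simp add: x_def)
  next
    case False
    then show ?thesis using that[of "sgn c"] norm_sgn[of c] by (simp add: x_def sgn_eq)
  qed
  define W where "W = cnj e ^ 2 * w"
  have ee: "e * cnj e = 1"
    using e(2) by (simp add: complex_norm_square[symmetric])
  have w_eq: "w = e ^ 2 * W"
    using ee by (simp add: W_def flip: power_mult_distrib mult.assoc)
  have "cnj e * e ^ 4 = e ^ 3"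
    using ee by (simp add: eval_nat_numeral flip: mult.assoc) (simp add: mult.commute)
  then have 1: "cnj e * (e\<^sup>2 * W)\<^sup>2 = e ^ 3 * W\<^sup>2"
    by (simp add: power_mult_distrib flip: mult.assoc power_mult)
  define s where "s = 1 - x\<^sup>2"
  have "of_real s * (w' - cnj c * w\<^sup>2) + \<mu> * (c * (s * w)) + \<nu> * c ^ 3
      = s * w' + x * e ^ 3 * (\<nu> * x\<^sup>2 + s * (\<mu> * W - W\<^sup>2))"
  proof -
    \<comment> \<open>Over free variables this is a plain ring identity; conjugation and the
      relation \<open>e * cnj e = 1\<close> enter only through the premises.\<close>
    have expand: "s' * (w' - a) + m * (c * (s' * w)) + n * d = s' * w' + x' * f * (n * x'\<^sup>2 + s' * (m * W - W\<^sup>2))"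
      if "a = x' * (f * W\<^sup>2)" "c * w = x' * (f * W)" "d = x' ^ 3 * f" for a d f m n s' x' :: complex
    proof -
      have "m * (c * (s' * w)) = m * s' * (c * w)" by simp
      then show ?thesis
        unfolding that by (simp add: algebra_simps power2_eq_square power3_eq_cube)
    qed
    have 2: "cnj c * w\<^sup>2 = x * (e ^ 3 * W\<^sup>2)" by (simp add: w_eq 1 e(1))
    have 3: "c * w = x * (e ^ 3 * W)"
      by (simp add: w_eq e(1) power2_eq_square power3_eq_cube)
    have 4: "c ^ 3 = of_real x ^ 3 * e ^ 3" unfolding e(1) power_mult_distrib by simp
    show ?thesis
      using expand[of _ x "e ^ 3", OF 2 3, of "c ^ 3" s \<mu> \<nu>, OF 4]
      by (simp only: of_real_mult of_real_power)
  qed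
  also have "norm \<dots> \<le> s * (1 - (norm w)\<^sup>2) + x * norm (\<nu> * x\<^sup>2 + s * (\<mu> * W - W\<^sup>2))"
  proof (rule norm_triangle_le, intro add_mono)
    have "0 \<le> s" using c by (simp add: s_def x_def power_le_one)
    then show "norm (of_real s * w') \<le> s * (1 - (norm w)\<^sup>2)"
      using w(2) by (simp add: norm_mult mult_left_mono)
    show "norm (x * e ^ 3 * (\<nu> * x\<^sup>2 + s * (\<mu> * W - W\<^sup>2))) \<le> x * norm (\<nu> * x\<^sup>2 + s * (\<mu> * W - W\<^sup>2))"
      using x0 by (simp add: norm_mult norm_power e(2))
  qed
  also have "\<dots> \<le> \<nu>"
  proof -
    have "norm W = norm w" by (simp add: W_def norm_mult norm_power e(2))
    then show ?thesis
      using rotated_third_coefficient_bound[of x \<nu> \<mu> W] c w \<nu> by (simp add: s_def x_def add.commute)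
  qed
  finally show ?thesis by (simp add: s_def x_def)
qed

text \<open>\<open>D1\<close> and \<open>D2\<close> lie on or above the parabola
  \<open>\<nu> = (\<mu>^2 + 8) / 12\<close> and satisfy \<open>\<nu> \<ge> 1\<close>. The boundary
  rays of \<open>D3\<close> are tangent to it at \<open>\<bar>\<mu>\<bar> = 4\<close>, so
  \<open>D3\<close> reaches below it; there the bound is carried over from the points of tangency,
  the functional being affine in \<open>(\<mu>, \<nu>)\<close>.\<close>

lemma prokhorov_szynal:
  assumes \<omega>: "schwarz_function \<omega>" and D: "(\<mu>, \<nu>) \<in> D1 \<union> D2 \<union> D3"
  shows "norm (taylor_coeff \<omega> 3 + of_real \<mu> * (taylor_coeff \<omega> 1 * taylor_coeff \<omega> 2)
      + of_real \<nu> * taylor_coeff \<omega> 1 ^ 3) \<le> \<nu>"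
proof -
  define c where "c = taylor_coeff \<omega> 1"
  obtain w w' where c: "norm c \<le> 1" and w: "norm w \<le> 1" "norm w' \<le> 1 - (norm w)\<^sup>2"
    and c2: "taylor_coeff \<omega> 2 = of_real (1 - (norm c)\<^sup>2) * w"
    and c3: "taylor_coeff \<omega> 3 = of_real (1 - (norm c)\<^sup>2) * (w' - cnj c * w\<^sup>2)"
    using schwarz_coefficients[OF \<omega>] unfolding c_def by metis
  have parabola: "norm (taylor_coeff \<omega> 3 + of_real m * (c * taylor_coeff \<omega> 2) + of_real n * c ^ 3) \<le> n"
    if "1 \<le> n" "(m\<^sup>2 + 8) / 12 \<le> n" for m n :: real
    using third_coefficient_bound_parabola[OF c w that] by (simp add: c2 c3)
  from D consider "\<bar>\<mu>\<bar> \<le> 2" "1 \<le> \<nu>"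
    | "2 \<le> \<bar>\<mu>\<bar>" "(\<mu>\<^sup>2 + 8) / 12 \<le> \<nu>"
    | "4 \<le> \<bar>\<mu>\<bar>" "2 / 3 * (\<bar>\<mu>\<bar> - 1) \<le> \<nu>"
    by (auto simp: D1_def D2_def D3_def)
  then have "norm (taylor_coeff \<omega> 3 + of_real \<mu> * (c * taylor_coeff \<omega> 2) + of_real \<nu> * c ^ 3) \<le> \<nu>"
  proof cases
    case 1
    then have "\<mu>\<^sup>2 \<le> 2\<^sup>2" by (intro abs_le_square_iff[THEN iffD1]) simp
    then show ?thesis using 1 by (intro parabola) auto
  next
    case 2
    then have "2\<^sup>2 \<le> \<mu>\<^sup>2" by (intro abs_le_square_iff[THEN iffD1]) simp
    then show ?thesis using 2 by (intro parabola) auto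
  next
    case 3
    \<comment> \<open>From the corner point with \<open>\<bar>\<mu>\<bar> = 4\<close>, \<open>\<nu> = 2\<close>, move along the direction
      \<open>(1, 2/3)\<close> of the boundary ray and then upwards.\<close>
    define m r u where "m = 4 * sgn \<mu>" and "r = \<bar>\<mu>\<bar> - 4" and "u = \<nu> - 2 / 3 * (\<bar>\<mu>\<bar> - 1)"
    define x where "x = norm c"
    have x: "0 \<le> x" "x \<le> 1" using c by (auto simp: x_def)
    have ru: "0 \<le> r" "0 \<le> u" using 3 by (auto simp: r_def u_def)
    have \<mu>: "\<mu> = m + sgn \<mu> * r" "norm (sgn \<mu>) = 1"
      using 3 by (auto simp: m_def r_def sgn_if)
    have \<nu>: "\<nu> = 2 + 2 / 3 * r + u" by (simp add: r_def u_def field_simps)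
    have "m\<^sup>2 = 16" using 3 by (auto simp: m_def sgn_if)
    then have A: "norm (taylor_coeff \<omega> 3 + of_real m * (c * taylor_coeff \<omega> 2) + of_real 2 * c ^ 3) \<le> 2"
      by (intro parabola) auto
    have "norm (c * taylor_coeff \<omega> 2) \<le> x * (1 - x\<^sup>2)"
    proof -
      have "(1 - x\<^sup>2) * norm w \<le> (1 - x\<^sup>2) * 1"
        using x w by (intro mult_left_mono) (auto simp: power_le_one)
      then show ?thesis
        using x by (simp add: c2 norm_mult x_def[symmetric] power_le_one mult_left_mono del: of_real_diff)
    qed
    \<comment> \<open>The left side is \<open>x - x ^ 3 / 3\<close>, which increases on the unit
      interval to its value 2/3 at 1. This is why the slope 2/3 of the ray suffices.\<close>
    moreover have "x * (1 - x\<^sup>2) + 2 / 3 * x ^ 3 \<le> 2 / 3"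
    proof -
      have "2 / 3 - (x * (1 - x\<^sup>2) + 2 / 3 * x ^ 3) = (1 - x)\<^sup>2 * (2 + x) / 3"
        by (simp add: field_simps power2_eq_square power3_eq_cube)
      also have "\<dots> \<ge> 0" using x by simp
      finally show ?thesis by simp
    qed
    ultimately have B: "norm (c * taylor_coeff \<omega> 2) + 2 / 3 * x ^ 3 \<le> 2 / 3" by linarith
    have "norm (of_real (sgn \<mu>) * (c * taylor_coeff \<omega> 2) + of_real (2 / 3) * c ^ 3) \<le> 2 / 3"
      by (rule norm_triangle_le) (use B \<mu>(2) in \<open>simp add: norm_mult norm_power x_def\<close>)
    then have C: "norm (of_real r * (of_real (sgn \<mu>) * (c * taylor_coeff \<omega> 2) + of_real (2 / 3) * c ^ 3))
        \<le> r * (2 / 3)"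
      unfolding norm_mult[of "of_real r"] using ru by (intro mult_mono) auto
    have E: "norm (of_real u * c ^ 3) \<le> u"
      using ru x by (simp add: norm_mult norm_power x_def[symmetric] mult_left_le power_le_one)
    have "taylor_coeff \<omega> 3 + of_real \<mu> * (c * taylor_coeff \<omega> 2) + of_real \<nu> * c ^ 3 =
        (taylor_coeff \<omega> 3 + of_real m * (c * taylor_coeff \<omega> 2) + of_real 2 * c ^ 3)
        + of_real r * (of_real (sgn \<mu>) * (c * taylor_coeff \<omega> 2) + of_real (2 / 3) * c ^ 3)
        + of_real u * c ^ 3"
      unfolding \<nu> by (subst \<mu>(1)) (simp add: algebra_simps)
    also have "norm \<dots> \<le> 2 + r * (2 / 3) + u"
      by (intro norm_triangle_le add_mono A C E)
    finally show ?thesis by (simp add: \<nu>)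
  qed
  then show ?thesis unfolding c_def .
qed

section \<open>Logarithmic coefficients\<close>

text \<open>This is the logarithmic derivative of \<open>f z = z * exp (L z)\<close>; at the origin
  both sides are 1 by the convention in \<open>starlike_quotient\<close>.\<close>

lemma log_branch_deriv:
  assumes f: "f \<in> class_S" and L: "log_branch f L" and z: "z \<in> unit_disc"
  shows "z * deriv L z + 1 = starlike_quotient f z"
proof (cases "z = 0")
  case False
  have holL: "L holomorphic_on unit_disc" and eL: "\<And>u. u \<in> unit_disc - {0} \<Longrightarrow> exp (L u) = f u / u"
    using L by (auto simp: log_branch_def)
  have holf: "f holomorphic_on unit_disc"
    using f by (auto simp: class_S_def)
  have "((\<lambda>u. u * exp (L u)) has_field_derivative (exp (L z) + z * (exp (L z) * deriv L z))) (at z)"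
    using holomorphic_derivI[OF holL open_ball z] by (auto intro!: derivative_eq_intros)
  then have "(f has_field_derivative (exp (L z) + z * (exp (L z) * deriv L z))) (at z)"
    by (rule has_field_derivative_transform_within_open[where S = "unit_disc - {0}"])
       (use z False eL in auto)
  then have "deriv f z = exp (L z) * (1 + z * deriv L z)"
    by (simp add: DERIV_imp_deriv algebra_simps)
  moreover have "f z = z * exp (L z)"
    using eL[of z] z False by simp
  ultimately show ?thesis
    using False by (simp add: starlike_quotient_def field_simps)
qed (simp add: starlike_quotient_def)

text \<open>Uniqueness of the branch frees \<open>log_coeff\<close> from the choice operator in its
  definition.\<close>

lemma log_coeff_eq_taylor_coeff:
  assumes f: "f \<in> class_S" and L: "log_branch f L"
  shows "log_coeff f n = taylor_coeff L n / 2"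
proof -
  define M where "M = (SOME L. log_branch f L)"
  have M: "log_branch f M"
    unfolding M_def using log_branch_exists[OF f] by (rule someI_ex)
  have hol: "L holomorphic_on unit_disc" "M holomorphic_on unit_disc"
    using L M by (auto simp: log_branch_def)
  have "Abs_fps (taylor_coeff L) = Abs_fps (taylor_coeff M)"
    by (rule has_fps_expansion_unique_on_disc[OF hol[THEN taylor_coeff_expansion]])
      (rule log_branch_unique[OF f L M])
  then have "taylor_coeff L = taylor_coeff M"
    by (simp add: Abs_fps_inject)
  then show ?thesis by (simp add: log_coeff_def M_def)
qed

lemma log_coeff_subordinate:
  assumes f: "f \<in> class_S" and \<phi>: "\<phi> holomorphic_on unit_disc" and \<omega>: "schwarz_function \<omega>"
    and eq: "\<And>z. z \<in> unit_disc \<Longrightarrow> starlike_quotient f z = \<phi> (\<omega> z)"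
  shows "4 * log_coeff f 2 =
      taylor_coeff \<phi> 1 * taylor_coeff \<omega> 2 + taylor_coeff \<phi> 2 * taylor_coeff \<omega> 1 ^ 2" (is ?two)
    and "6 * log_coeff f 3 = taylor_coeff \<phi> 1 * taylor_coeff \<omega> 3
      + 2 * taylor_coeff \<phi> 2 * (taylor_coeff \<omega> 1 * taylor_coeff \<omega> 2)
      + taylor_coeff \<phi> 3 * taylor_coeff \<omega> 1 ^ 3" (is ?three)
proof -
  obtain L where L: "log_branch f L" using log_branch_exists[OF f] by blast
  define LL FF WW where "LL = Abs_fps (taylor_coeff L)" and "FF = Abs_fps (taylor_coeff \<phi>)"
    and "WW = Abs_fps (taylor_coeff \<omega>)"
  have exps: "L has_fps_expansion LL" "\<phi> has_fps_expansion FF" "\<omega> has_fps_expansion WW"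
    unfolding LL_def FF_def WW_def
    using L \<phi> \<omega> by (auto intro!: taylor_coeff_expansion simp: log_branch_def schwarz_function_def)
  have W0: "WW $ 0 = 0"
    using \<omega> by (simp add: WW_def taylor_coeff_def schwarz_function_def)
  have E: "fps_X * fps_deriv LL + 1 = fps_compose FF WW"
  proof (rule has_fps_expansion_unique_on_disc)
    show "(\<lambda>z. z * deriv L z + 1) has_fps_expansion fps_X * fps_deriv LL + 1"
      by (intro fps_expansion_intros exps)
    show "(\<phi> \<circ> \<omega>) has_fps_expansion fps_compose FF WW"
      by (intro fps_expansion_intros exps W0)
    show "z * deriv L z + 1 = (\<phi> \<circ> \<omega>) z" if "z \<in> unit_disc" for z
      using log_branch_deriv[OF f L that] eq[OF that] by simp
  qed
  have "2 * LL $ 2 = FF $ 1 * WW $ 2 + FF $ 2 * (WW $ 1) ^ 2"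
    using arg_cong[OF E, of "\<lambda>F. fps_nth F 2"]
    by (simp add: fps_compose_nth fps_mult_nth W0 eval_nat_numeral)
  then show ?two
    by (simp add: log_coeff_eq_taylor_coeff[OF f L] LL_def FF_def WW_def)
  have "3 * LL $ 3 = FF $ 1 * WW $ 3 + 2 * FF $ 2 * (WW $ 1 * WW $ 2) + FF $ 3 * (WW $ 1) ^ 3"
    using arg_cong[OF E, of "\<lambda>F. fps_nth F 3"]
    by (simp add: fps_compose_nth fps_mult_nth W0 eval_nat_numeral algebra_simps)
  then show ?three
    by (simp add: log_coeff_eq_taylor_coeff[OF f L] LL_def FF_def WW_def)
qed

section \<open>The upper bound\<close>

lemma S_star_log_coeff_bound:
  assumes mm: "ma_minda \<phi>" and B2: "\<bar>mm_coeff \<phi> 2\<bar> \<ge> mm_coeff \<phi> 1"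
    and D: "(2 * mm_coeff \<phi> 2 / mm_coeff \<phi> 1, mm_coeff \<phi> 3 / mm_coeff \<phi> 1) \<in> D1 \<union> D2 \<union> D3"
    and f: "f \<in> S_star \<phi>"
  shows "norm ((log_coeff f 2)\<^sup>2 - (log_coeff f 3)\<^sup>2)
    \<le> 1 / 144 * (9 * (mm_coeff \<phi> 2)\<^sup>2 + 4 * (mm_coeff \<phi> 3)\<^sup>2)"
proof -
  obtain \<omega> where \<omega>: "schwarz_function \<omega>"
    and eq: "\<And>z. z \<in> unit_disc \<Longrightarrow> starlike_quotient f z = \<phi> (\<omega> z)"
    and fS: "f \<in> class_S"
    using f by (auto simp: S_star_def subordinate_def)
  have hol: "\<phi> holomorphic_on unit_disc" and B1: "mm_coeff \<phi> 1 > 0"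
    using mm by (auto simp: ma_minda_def mm_coeff_def taylor_coeff_def)
  define B where "B = mm_coeff \<phi>"
  define c where "c = taylor_coeff \<omega>"
  have coeffs: "4 * log_coeff f 2 = B 1 * c 2 + B 2 * c 1 ^ 2"
    "6 * log_coeff f 3 = B 1 * c 3 + 2 * B 2 * (c 1 * c 2) + B 3 * c 1 ^ 3"
    using log_coeff_subordinate[OF fS hol \<omega>] eq
    by (simp_all add: ma_minda_taylor_coeff[OF mm] B_def c_def)
  obtain w w' where c1: "norm (c 1) \<le> 1" and w: "norm w \<le> 1"
    and c2: "c 2 = of_real (1 - (norm (c 1))\<^sup>2) * w"
    using schwarz_coefficients[OF \<omega>] unfolding c_def by metis
  have x2: "(norm (c 1))\<^sup>2 \<le> 1" using c1 by (simp add: power_le_one)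
  have "norm (4 * log_coeff f 2) \<le> norm (B 1 * c 2) + norm (B 2 * c 1 ^ 2)"
    unfolding coeffs(1) by (rule norm_triangle_ineq)
  also have "\<dots> \<le> \<bar>B 2\<bar> * (1 - (norm (c 1))\<^sup>2) + \<bar>B 2\<bar> * (norm (c 1))\<^sup>2"
  proof (intro add_mono)
    have "norm (of_real (B 1) * c 2) = \<bar>B 1\<bar> * ((1 - (norm (c 1))\<^sup>2) * norm w)"
      using x2 by (simp add: c2 norm_mult del: of_real_diff)
    \<comment> \<open>Here \<open>B 1 \<le> \<bar>B 2\<bar>\<close> enters: both terms get the
      weight \<open>\<bar>B 2\<bar>\<close>, and their remaining factors add up to 1.\<close>
    also have "\<dots> \<le> \<bar>B 2\<bar> * ((1 - (norm (c 1))\<^sup>2) * 1)"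
      using B1 B2 w x2 by (intro mult_mono mult_nonneg_nonneg) (auto simp: B_def)
    finally show "norm (of_real (B 1) * c 2) \<le> \<bar>B 2\<bar> * (1 - (norm (c 1))\<^sup>2)" by simp
  qed (simp add: norm_mult norm_power)
  also have "\<dots> = \<bar>B 2\<bar>" by (simp add: algebra_simps)
  finally have g2: "norm (log_coeff f 2) \<le> \<bar>B 2\<bar> / 4" by (simp add: norm_mult)
  have "6 * log_coeff f 3 = of_real (B 1) *
      (c 3 + of_real (2 * B 2 / B 1) * (c 1 * c 2) + of_real (B 3 / B 1) * c 1 ^ 3)"
    unfolding coeffs(2) using B1 by (simp add: field_simps B_def)
  also have "norm \<dots> \<le> \<bar>B 1\<bar> * (B 3 / B 1)"
    unfolding norm_mult norm_of_real
    using prokhorov_szynal[OF \<omega> D] by (intro mult_left_mono) (auto simp: B_def c_def)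
  also have "\<dots> = B 3" using B1 by (simp add: B_def)
  finally have g3: "norm (log_coeff f 3) \<le> B 3 / 6" by (simp add: norm_mult)
  have "norm ((log_coeff f 2)\<^sup>2 - (log_coeff f 3)\<^sup>2) \<le> (norm (log_coeff f 2))\<^sup>2 + (norm (log_coeff f 3))\<^sup>2"
    using norm_triangle_ineq4 by (metis norm_power)
  also have "\<dots> \<le> (\<bar>B 2\<bar> / 4)\<^sup>2 + (B 3 / 6)\<^sup>2"
    using g2 g3 by (intro add_mono power_mono) auto
  also have "\<dots> = 1 / 144 * (9 * (B 2)\<^sup>2 + 4 * (B 3)\<^sup>2)"
    by (simp add: power_divide field_simps)
  finally show ?thesis by (simp add: B_def)
qed

section \<open>Univalence of starlike functions\<close>

text \<open>Pull the segment \<open>(1 - \<epsilon>) * f z\<close> back by a local inverse of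
  \<open>f\<close>. With \<open>q = z * deriv f z / f z\<close> the resulting path starts at
  \<open>z\<close> with velocity \<open>- z / q\<close>, so its squared modulus has derivative
  \<open>- 2 * norm z ^ 2 * Re q / norm q ^ 2 < 0\<close>. The eventual form lets two points be
  moved with the same \<open>\<epsilon>\<close>.\<close>

lemma starlike_move_inward:
  assumes hol: "f holomorphic_on unit_disc" and z: "z \<in> unit_disc" and fz: "f z \<noteq> 0"
    and pos: "Re (z * deriv f z / f z) > 0" and \<delta>: "\<delta> > 0"
  shows "\<forall>\<^sub>F \<epsilon> in at_right 0. \<exists>a \<in> ball z \<delta>. norm a < norm z \<and> f a = (1 - of_real \<epsilon>) * f z"
proof -
  define q where "q = z * deriv f z / f z"
  have q: "Re q > 0" "q \<noteq> 0" and z0: "z \<noteq> 0" and f': "deriv f z \<noteq> 0"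
    using pos by (auto simp: q_def)
  obtain r where r: "r > 0" "ball z r \<subseteq> unit_disc" "inj_on f (ball z r)"
    using has_complex_derivative_locally_injective[OF hol z open_ball f'] by metis
  define B where "B = ball z (min r \<delta>)"
  have "B \<subseteq> unit_disc" using r by (auto simp: B_def)
  then have B: "open B" "z \<in> B" "inj_on f B" "f holomorphic_on B"
    using r \<delta> holomorphic_on_subset[OF hol] by (auto simp: B_def intro: inj_on_subset)
  obtain g where g: "g holomorphic_on (f ` B)" "\<And>u. u \<in> B \<Longrightarrow> deriv f u * deriv g (f u) = 1"
      "\<And>u. u \<in> B \<Longrightarrow> g (f u) = u"
    using holomorphic_has_inverse[OF B(4,1,3)] by metis
  have op: "open (f ` B)"
    using open_mapping_thm3[OF B(4,1,3)] .
  define l where "l = (\<lambda>\<epsilon>. (1 - complex_of_real \<epsilon>) * f z)"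
  define a where "a = g \<circ> l"
  have l: "(l has_vector_derivative - f z) (at 0)"
    unfolding l_def by (auto intro!: derivative_eq_intros)
  have l0: "l 0 = f z" by (simp add: l_def)
  have "(g has_field_derivative deriv g (l 0)) (at (l 0))"
    by (rule holomorphic_derivI[OF g(1) op]) (use B l0 in auto)
  from field_vector_diff_chain_at[OF l this]
  have a: "(a has_vector_derivative - f z * deriv g (f z)) (at 0)"
    by (simp add: a_def l0)
  have "- f z * deriv g (f z) = - z / q"
    using g(2)[OF B(2)] f' z0 fz by (simp add: q_def field_simps)
  with a have a: "(a has_vector_derivative - z / q) (at 0)" by simp
  have a0: "a 0 = z" using g(3) B by (simp add: a_def l0)
  define N where "N = (\<lambda>\<epsilon>. (Re (a \<epsilon>))\<^sup>2 + (Im (a \<epsilon>))\<^sup>2)"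
  have N: "(N has_real_derivative (2 * Re z * Re (- z / q) + 2 * Im z * Im (- z / q))) (at 0)"
    unfolding N_def using a by (auto intro!: derivative_eq_intros simp: a0)
  have "2 * Re z * Re (- z / q) + 2 * Im z * Im (- z / q) = - 2 * ((norm z)\<^sup>2 * Re q / (norm q)\<^sup>2)"
  proof -
    have *: "2 * x * (A / K) + 2 * y * (B / K) = - 2 * (M / K)" if "x * A + y * B = - M"
      for x y A B K M :: real
    proof -
      have "2 * x * (A / K) + 2 * y * (B / K) = 2 * ((x * A + y * B) / K)"
        by (simp add: add_divide_distrib)
      then show ?thesis using that by simp
    qed
    show ?thesis
      unfolding cmod_power2 Re_divide Im_divide
      by (rule *) (simp add: power2_eq_square algebra_simps)
  qed
  also have "\<dots> < 0" using q z0 by simp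
  finally obtain d where d: "d > 0" "\<And>\<epsilon>. 0 < \<epsilon> \<Longrightarrow> \<epsilon> < d \<Longrightarrow> N \<epsilon> < N 0"
    using DERIV_neg_dec_right[OF N] by auto
  have "\<forall>\<^sub>F \<epsilon> in at_right 0. norm (a \<epsilon>) < norm z"
    unfolding eventually_at_right_field
    using d by (intro exI[of _ d]) (auto simp: cmod_def N_def a0)
  moreover have "\<forall>\<^sub>F \<epsilon> in at_right 0. l \<epsilon> \<in> f ` B"
  proof -
    have "isCont l 0" using l has_vector_derivative_continuous by blast
    then have "(l \<longlongrightarrow> f z) (at_right 0)"
      unfolding isCont_def l0 by (rule tendsto_mono[OF at_le, rotated]) auto
    then show ?thesis using op B(2) by (intro topological_tendstoD) auto
  qed
  ultimately show ?thesis
  proof eventually_elim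
    case (elim \<epsilon>)
    then obtain u where u: "u \<in> B" "l \<epsilon> = f u" by blast
    then have "a \<epsilon> = u" using g(3) by (simp add: a_def)
    then show ?case using u elim by (auto simp: B_def l_def)
  qed
qed

text \<open>Among the pairs \<open>a \<noteq> b\<close> with \<open>f a = f b\<close> take one with \<open>max \<bar>a\<bar> \<bar>b\<bar>\<close> minimal; it exists since
  \<open>f\<close> is locally injective. Moving both points so that the common value shrinks to
  \<open>(1 - \<epsilon>) f a\<close> contradicts minimality.\<close>

lemma starlike_imp_inj_on:
  assumes hol: "f holomorphic_on unit_disc" and f0: "f 0 = 0" "deriv f 0 \<noteq> 0"
    and nz: "\<And>z. z \<in> unit_disc \<Longrightarrow> z \<noteq> 0 \<Longrightarrow> f z \<noteq> 0"
    and pos: "\<And>z. z \<in> unit_disc \<Longrightarrow> z \<noteq> 0 \<Longrightarrow> Re (z * deriv f z / f z) > 0"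
  shows "inj_on f unit_disc"
proof (rule ccontr)
  assume "\<not> inj_on f unit_disc"
  then obtain a0 b0 where ab0: "a0 \<in> unit_disc" "b0 \<in> unit_disc" "f a0 = f b0" "a0 \<noteq> b0"
    by (auto simp: inj_on_def)
  define \<rho> where "\<rho> = max (norm a0) (norm b0)"
  have \<rho>: "\<rho> < 1" using ab0 by (simp add: \<rho>_def)
  then have sub: "cball 0 \<rho> \<subseteq> unit_disc" by auto
  have loc: "\<exists>r>0. inj_on f (ball z r)" if "z \<in> unit_disc" for z
  proof -
    have "deriv f z \<noteq> 0" using pos[OF that] f0 by (cases "z = 0") auto
    then show ?thesis
      using has_complex_derivative_locally_injective[OF hol that open_ball] by metis
  qed
  \<comment> \<open>\<open>U\<close> is an open neighbourhood of the diagonal over the disc, and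
    \<open>f\<close> separates the two entries of any pair of distinct points in it. Removing it
    from \<open>C\<close> discards exactly the trivial coincidences and keeps compactness.\<close>
  define U where "U = \<Union>{ball z r \<times> ball z r | z r. inj_on f (ball z r)}"
  define C where "C = (cball 0 \<rho> \<times> cball 0 \<rho>) \<inter> {p. f (fst p) - f (snd p) = 0}"
  have "open U" unfolding U_def by (intro open_Union) (auto intro: open_Times)
  moreover have "compact C"
  proof -
    have cont: "continuous_on (cball 0 \<rho>) f"
      using holomorphic_on_imp_continuous_on[OF hol] sub continuous_on_subset by blast
    have "continuous_on (cball 0 \<rho> \<times> cball 0 \<rho>) (\<lambda>p. f (fst p) - f (snd p))"
      by (intro continuous_on_diff continuous_on_compose2[OF cont] continuous_intros) auto
    then have "closed ((cball 0 \<rho> \<times> cball 0 \<rho>) \<inter> (\<lambda>p. f (fst p) - f (snd p)) -` {0})"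
      by (intro continuous_closed_preimage closed_Times) auto
    moreover have "bounded (cball (0::complex) \<rho> \<times> cball (0::complex) \<rho>)"
      by (intro bounded_Times) auto
    ultimately show ?thesis
      unfolding C_def compact_eq_bounded_closed vimage_def
      by (auto intro: bounded_subset)
  qed
  ultimately have comp: "compact (C - U)" by (rule compact_diff[rotated])
  have CU: "(a, b) \<in> C - U \<longleftrightarrow> a \<in> cball 0 \<rho> \<and> b \<in> cball 0 \<rho> \<and> f a = f b \<and> a \<noteq> b" for a b
  proof -
    have "(a, a) \<in> U" if a: "a \<in> cball 0 \<rho>"
    proof -
      obtain r where "r > 0" "inj_on f (ball a r)" using loc[of a] a sub by blast
      then have "(a, a) \<in> ball a r \<times> ball a r" "inj_on f (ball a r)" by auto
      then show ?thesis unfolding U_def by blast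
    qed
    moreover have "a = b" if U: "(a, b) \<in> U" "f a = f b"
    proof -
      obtain z r where "inj_on f (ball z r)" "a \<in> ball z r" "b \<in> ball z r"
        using U(1) unfolding U_def by blast
      then show ?thesis using U(2) by (blast dest: inj_onD)
    qed
    ultimately show ?thesis unfolding C_def by auto
  qed
  have "(a0, b0) \<in> C - U" using ab0 unfolding CU by (simp add: \<rho>_def)
  moreover have "continuous_on (C - U) (\<lambda>p. max (norm (fst p)) (norm (snd p)))"
    by (intro continuous_intros)
  ultimately obtain p where p: "p \<in> C - U"
    and minp: "\<forall>y \<in> C - U. max (norm (fst p)) (norm (snd p)) \<le> max (norm (fst y)) (norm (snd y))"
    using continuous_attains_inf[OF comp] by blast
  obtain a b where pab: "p = (a, b)" by (cases p)
  have ab: "(a, b) \<in> C - U" using p pab by simp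
  have min: "max (norm a) (norm b) \<le> max (norm a') (norm b')" if "(a', b') \<in> C - U" for a' b'
    using bspec[OF minp that] pab by simp
  have fab: "f a = f b" "a \<noteq> b" and disc: "a \<in> unit_disc" "b \<in> unit_disc"
    and cb: "norm a \<le> \<rho>" "norm b \<le> \<rho>"
    using ab[unfolded CU] sub by auto
  have nz_ab: "a \<noteq> 0" "b \<noteq> 0" using fab nz[of a] nz[of b] f0 disc by auto
  \<comment> \<open>Half the distance makes the two balls disjoint, so the moved points stay
    distinct.\<close>
  define \<delta> where "\<delta> = dist a b / 2"
  have \<delta>: "\<delta> > 0" using fab by (simp add: \<delta>_def)
  have "\<forall>\<^sub>F \<epsilon> in at_right 0. \<exists>a' \<in> ball a \<delta>. norm a' < norm a \<and> f a' = (1 - of_real \<epsilon>) * f a"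
    by (intro starlike_move_inward hol disc \<delta> pos nz nz_ab)
  moreover have "\<forall>\<^sub>F \<epsilon> in at_right 0. \<exists>b' \<in> ball b \<delta>. norm b' < norm b \<and> f b' = (1 - of_real \<epsilon>) * f b"
    by (intro starlike_move_inward hol disc \<delta> pos nz nz_ab)
  ultimately have "\<forall>\<^sub>F \<epsilon> in at_right (0::real). \<exists>a' b'. a' \<in> ball a \<delta> \<and> b' \<in> ball b \<delta> \<and>
      norm a' < norm a \<and> norm b' < norm b \<and> f a' = f b'"
  proof eventually_elim
    case (elim \<epsilon>)
    then obtain a' b' where "a' \<in> ball a \<delta>" "norm a' < norm a" "f a' = (1 - of_real \<epsilon>) * f a"
        "b' \<in> ball b \<delta>" "norm b' < norm b" "f b' = (1 - of_real \<epsilon>) * f b"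
      by blast
    then show ?case using fab(1) by (intro exI[of _ a'] exI[of _ b']) simp
  qed
  then obtain a' b' where ab': "a' \<in> ball a \<delta>" "b' \<in> ball b \<delta>" "norm a' < norm a"
      "norm b' < norm b" "f a' = f b'"
    using eventually_happens'[OF trivial_limit_at_right_real] by blast
  have "a' \<noteq> b'"
    using ab'(1,2) dist_triangle_half_r[of a' a "2 * \<delta>" b] by (auto simp: \<delta>_def dist_commute)
  then have "(a', b') \<in> C - U"
    using ab' cb unfolding CU by auto
  from min[OF this] show False using ab' by auto
qed

text \<open>The equation \<open>z * deriv f z / f z = p z\<close> is solved by
  \<open>f z = z * exp (L z - L 0)\<close> with \<open>L\<close> a primitive of
  \<open>(p z - 1) / z\<close>; subtracting \<open>L 0\<close> normalises \<open>deriv f 0\<close>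
  to 1. Univalence comes from \<open>starlike_imp_inj_on\<close>, as \<open>p\<close> has positive
  real part.\<close>

lemma starlike_function_exists:
  assumes p: "p holomorphic_on unit_disc" "p 0 = 1" "\<And>z. z \<in> unit_disc \<Longrightarrow> Re (p z) > 0"
  obtains f where "f \<in> class_S" "\<And>z. z \<in> unit_disc \<Longrightarrow> starlike_quotient f z = p z"
proof -
  have "(\<lambda>z. p z - 1) holomorphic_on unit_disc" "p 0 - 1 = 0"
    using p by (simp_all add: holomorphic_on_diff)
  from Schwarz3[OF this] obtain h where h: "h holomorphic_on unit_disc"
      "\<And>z. norm z < 1 \<Longrightarrow> p z - 1 = z * h z"
    by blast
  obtain L where L: "\<And>z. z \<in> unit_disc \<Longrightarrow> (L has_field_derivative h z) (at z within unit_disc)"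
  proof (rule holomorphic_convex_primitive'[OF convex_ball open_ball h(1)])
  qed (rule that)
  define f where "f = (\<lambda>z. z * exp (L z - L 0))"
  have f: "(f has_field_derivative exp (L z - L 0) * p z) (at z)" if z: "z \<in> unit_disc" for z
  proof -
    have "(L has_field_derivative h z) (at z)"
      using L[OF z] unfolding at_within_open[OF z open_ball] .
    then have "(f has_field_derivative exp (L z - L 0) + z * (exp (L z - L 0) * h z)) (at z)"
      unfolding f_def by (auto intro!: derivative_eq_intros)
    also have "exp (L z - L 0) + z * (exp (L z - L 0) * h z) = exp (L z - L 0) * (1 + z * h z)"
      by (simp add: algebra_simps)
    also have "1 + z * h z = p z" using h(2)[of z] z by (simp add: algebra_simps)
    finally show ?thesis .
  qed
  have hol: "f holomorphic_on unit_disc"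
    unfolding holomorphic_on_open[OF open_ball] using f by blast
  have f': "deriv f z = exp (L z - L 0) * p z" if "z \<in> unit_disc" for z
    using f[OF that] by (rule DERIV_imp_deriv)
  have quot: "z * deriv f z / f z = p z" if "z \<in> unit_disc" "z \<noteq> 0" for z
    unfolding f'[OF that(1)] using that(2) by (simp add: f_def)
  have d0: "f 0 = 0" by (simp add: f_def)
  have d1: "deriv f 0 = 1" using f'[of 0] p by simp
  have "inj_on f unit_disc"
  proof (rule starlike_imp_inj_on[OF hol])
    show "Re (z * deriv f z / f z) > 0" if "z \<in> unit_disc" "z \<noteq> 0" for z
      unfolding quot[OF that] by (rule p(3)[OF that(1)])
  qed (simp_all add: d0 d1, simp add: f_def)
  then have "f \<in> class_S" using hol d0 d1 by (simp add: class_S_def)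
  moreover have "starlike_quotient f z = p z" if "z \<in> unit_disc" for z
    using quot[OF that] p(2) by (simp add: starlike_quotient_def)
  ultimately show ?thesis using that by blast
qed

section \<open>Sharpness\<close>

lemma S_star_log_coeff_sharp:
  assumes mm: "ma_minda \<phi>"
  shows "\<exists>f \<in> S_star \<phi>. norm ((log_coeff f 2)\<^sup>2 - (log_coeff f 3)\<^sup>2)
    = 1 / 144 * (9 * (mm_coeff \<phi> 2)\<^sup>2 + 4 * (mm_coeff \<phi> 3)\<^sup>2)"
proof -
  have \<phi>: "\<phi> holomorphic_on unit_disc" "\<phi> 0 = 1" "\<And>z. z \<in> unit_disc \<Longrightarrow> Re (\<phi> z) > 0"
    using mm by (auto simp: ma_minda_def)
  define \<omega> where "\<omega> = (\<lambda>z. \<i> * z)"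
  have \<omega>: "schwarz_function \<omega>"
    by (auto simp: schwarz_function_def \<omega>_def norm_mult intro!: holomorphic_intros)
  have "(\<phi> \<circ> \<omega>) holomorphic_on unit_disc"
    using \<omega> \<phi>(1) by (intro holomorphic_on_compose_gen) (auto simp: schwarz_function_def)
  moreover have "(\<phi> \<circ> \<omega>) 0 = 1" using \<phi> by (simp add: \<omega>_def)
  moreover have "Re ((\<phi> \<circ> \<omega>) z) > 0" if "z \<in> unit_disc" for z
    using \<phi>(3)[of "\<omega> z"] that by (simp add: \<omega>_def norm_mult)
  ultimately obtain f where f: "f \<in> class_S"
    and "\<And>z. z \<in> unit_disc \<Longrightarrow> starlike_quotient f z = (\<phi> \<circ> \<omega>) z"
    using starlike_function_exists by blast
  then have eq: "starlike_quotient f z = \<phi> (\<omega> z)" if "z \<in> unit_disc" for z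
    using that by simp
  then have "f \<in> S_star \<phi>"
    using f \<omega> by (auto simp: S_star_def subordinate_def)
  have "\<omega> has_fps_expansion fps_const \<i> * fps_X"
    unfolding \<omega>_def by (intro fps_expansion_intros)
  note nth = fps_nth_fps_expansion[OF this]
  have c: "taylor_coeff \<omega> n = (if n = 1 then \<i> else 0)" for n
    unfolding taylor_coeff_def by (auto simp flip: nth)
  \<comment> \<open>Only the first coefficient \<open>\<i>\<close> of \<open>\<omega>\<close> is
    nonzero, so just its square -1 and its cube \<open>- \<i>\<close> survive.\<close>
  have "4 * log_coeff f 2 = - mm_coeff \<phi> 2" "6 * log_coeff f 3 = - \<i> * mm_coeff \<phi> 3"
    using log_coeff_subordinate[OF f \<phi>(1) \<omega>] eq
    by (simp_all add: ma_minda_taylor_coeff[OF mm] c power3_eq_cube)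
  then have g: "log_coeff f 2 = - mm_coeff \<phi> 2 / 4" "log_coeff f 3 = - \<i> * mm_coeff \<phi> 3 / 6"
    by (simp_all add: field_simps)
  have "(log_coeff f 2)\<^sup>2 - (log_coeff f 3)\<^sup>2
      = of_real (1 / 144 * (9 * (mm_coeff \<phi> 2)\<^sup>2 + 4 * (mm_coeff \<phi> 3)\<^sup>2))"
    unfolding g by (simp add: power_divide power_mult_distrib field_simps)
  then have "norm ((log_coeff f 2)\<^sup>2 - (log_coeff f 3)\<^sup>2)
      = 1 / 144 * (9 * (mm_coeff \<phi> 2)\<^sup>2 + 4 * (mm_coeff \<phi> 3)\<^sup>2)"
    by (simp only: norm_of_real) simp
  with \<open>f \<in> S_star \<phi>\<close> show ?thesis by blast
qed

theorem theorem2p3: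
  fixes \<phi> :: "complex \<Rightarrow> complex"
  assumes "ma_minda \<phi>"
    and "\<bar>mm_coeff \<phi> 2\<bar> \<ge> mm_coeff \<phi> 1"
    and "(2 * mm_coeff \<phi> 2 / mm_coeff \<phi> 1, mm_coeff \<phi> 3 / mm_coeff \<phi> 1) \<in> D1 \<union> D2 \<union> D3"
  shows "(\<forall>f \<in> S_star \<phi>. norm ((log_coeff f 2)\<^sup>2 - (log_coeff f 3)\<^sup>2)
            \<le> 1 / 144 * (9 * (mm_coeff \<phi> 2)\<^sup>2 + 4 * (mm_coeff \<phi> 3)\<^sup>2)) \<and>
         (\<exists>f \<in> S_star \<phi>. norm ((log_coeff f 2)\<^sup>2 - (log_coeff f 3)\<^sup>2)
            = 1 / 144 * (9 * (mm_coeff \<phi> 2)\<^sup>2 + 4 * (mm_coeff \<phi> 3)\<^sup>2))"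
  using S_star_log_coeff_bound[OF assms] S_star_log_coeff_sharp[OF assms(1)] by blast

end
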